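(* Let $M$ be a locally complete metric space and let $X$ be an arc field on $M$ satisfying Conditions E1 and E2, with local flow $F$. Assume $S\subset M$ is a closed set with $S\sim X$. Then for any $x\in S$ we have $F_t(x)\in S$ for all $t\in(\alpha_x,\beta_x)$; i.e. $S$ is an invariant set under the flow $F$.
   Context: $(M,d)$ is locally complete if each point has a complete neighborhood. $B(x,r)$ is the open ball. An arc field on $M$ is a continuous map $X:M\times[-1,1]\to M$ with $X(x,0)=x$, such that $\rho(x):=\sup_{s\ne t} d(X(x,s),X(x,t))/|s-t|<\infty$ for each $x$ and $\rho$ is locally bounded. Write $X(x,t)=X_x(t)=X_t(x)$. Condition E1: for each $x_0$ there are $r,\delta,\Lambda_X>0$ with $d(X_t(x),X_t(y))\le d(x,y)(1+|t|\Lambda_X)$ for all $x,y\in B(x_0,r)$, $|t|<\delta$. Condition E2: for each $x_0$ there are $r,\delta,\Omega_X>0$ with $d(X_{s+t}(x),X_t(X_s(x)))\le|st|\Omega_X$ for all $x\in B(x_0,r)$, $|s|,|t|<\delta$. A solution curve to $X$ is a continuous $\sigma:(\alpha,\beta)\to M$ with $\lim_{h\to0} d(\sigma(t+h),X(\sigma(t),h))/h=0$ for each $t$. If $X$ satisfies E1 and E2 it is known that there is a unique maximal solution $\sigma_x:(\alpha_x,\beta_x)\to M$ with $\sigma_x(0)=x$; the local flow of $X$ is $F_t(x):=\sigma_x(t)$ for $t\in(\alpha_x,\beta_x)$. For $S\subset M$, $d(y,S):=\inf\{d(y,z):z\in S\}$, and $S\sim X$ ($S$ is locally uniformly tangent to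 $X$) means $d(X_t(y),S)=o(t)$ locally uniformly for $y\in S$. *)

theory Defs
  imports "HOL-Analysis.Analysis"
begin

definition locally_complete :: "'a::metric_space itself \<Rightarrow> bool" where
  "locally_complete _ \<longleftrightarrow> (\<forall>x::'a. \<exists>U. complete U \<and> x \<in> interior U)"

(* A map M x [-1,1] -> M is represented by a total function on M x R; its values
   at times outside [-1,1] are arbitrary. *)

definition arc_quotients :: "('a::metric_space \<Rightarrow> real \<Rightarrow> 'a) \<Rightarrow> 'a \<Rightarrow> real set" where
  "arc_quotients X x =
     {dist (X x s) (X x t) / \<bar>s - t\<bar> | s t. s \<in> {-1..1} \<and> t \<in> {-1..1} \<and> s \<noteq> t}"

definition arc_speed :: "('a::metric_space \<Rightarrow> real \<Rightarrow> 'a) \<Rightarrow> 'a \<Rightarrow> real" where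
  "arc_speed X x = Sup (arc_quotients X x)"

(* Sup on the reals is meaningful only for sets bounded above, so finiteness of the
   speed is the separate condition bdd_above. *)

definition arc_field :: "('a::metric_space \<Rightarrow> real \<Rightarrow> 'a) \<Rightarrow> bool" where
  "arc_field X \<longleftrightarrow>
     continuous_on (UNIV \<times> {-1..1}) (\<lambda>(x, t). X x t) \<and>
     (\<forall>x. X x 0 = x) \<and>
     (\<forall>x. bdd_above (arc_quotients X x)) \<and>
     (\<forall>x. \<exists>r>0. bdd_above (arc_speed X ` ball x r))"

(* In the next two conditions d may always be decreased, e.g. to at most 1/2, so they
   put no constraint on the values of X at times outside [-1,1]. *)

definition condition_E1 :: "('a::metric_space \<Rightarrow> real \<Rightarrow> 'a) \<Rightarrow> bool" where
  "condition_E1 X \<longleftrightarrow>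
     (\<forall>x0. \<exists>r>0. \<exists>d>0. \<exists>L>0. \<forall>x \<in> ball x0 r. \<forall>y \<in> ball x0 r. \<forall>t.
        \<bar>t\<bar> < d \<longrightarrow> dist (X x t) (X y t) \<le> dist x y * (1 + \<bar>t\<bar> * L))"

definition condition_E2 :: "('a::metric_space \<Rightarrow> real \<Rightarrow> 'a) \<Rightarrow> bool" where
  "condition_E2 X \<longleftrightarrow>
     (\<forall>x0. \<exists>r>0. \<exists>d>0. \<exists>W>0. \<forall>x \<in> ball x0 r. \<forall>s t.
        \<bar>s\<bar> < d \<and> \<bar>t\<bar> < d \<longrightarrow> dist (X x (s + t)) (X (X x s) t) \<le> \<bar>s * t\<bar> * W)"

(* The open interval (a,b) of real numbers, with possibly infinite endpoints. *)
definition time_interval :: "ereal \<Rightarrow> ereal \<Rightarrow> real set" where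
  "time_interval a b = {t. a < ereal t \<and> ereal t < b}"

definition solution_curve ::
  "('a::metric_space \<Rightarrow> real \<Rightarrow> 'a) \<Rightarrow> ereal \<Rightarrow> ereal \<Rightarrow> (real \<Rightarrow> 'a) \<Rightarrow> bool" where
  "solution_curve X a b \<sigma> \<longleftrightarrow>
     continuous_on (time_interval a b) \<sigma> \<and>
     (\<forall>t \<in> time_interval a b. ((\<lambda>h. dist (\<sigma> (t + h)) (X (\<sigma> t) h) / h) \<longlongrightarrow> 0) (at 0))"

definition solution_from ::
  "('a::metric_space \<Rightarrow> real \<Rightarrow> 'a) \<Rightarrow> 'a \<Rightarrow> ereal \<Rightarrow> ereal \<Rightarrow> (real \<Rightarrow> 'a) \<Rightarrow> bool" where
  "solution_from X x a b \<sigma> \<longleftrightarrow>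
     0 \<in> time_interval a b \<and> \<sigma> 0 = x \<and> solution_curve X a b \<sigma>"

(* The unique maximal solution: every solution with the same initial value is a
   restriction of it. *)
definition maximal_solution_from ::
  "('a::metric_space \<Rightarrow> real \<Rightarrow> 'a) \<Rightarrow> 'a \<Rightarrow> ereal \<Rightarrow> ereal \<Rightarrow> (real \<Rightarrow> 'a) \<Rightarrow> bool" where
  "maximal_solution_from X x a b \<sigma> \<longleftrightarrow>
     solution_from X x a b \<sigma> \<and>
     (\<forall>a' b' \<tau>. solution_from X x a' b' \<tau> \<longrightarrow>
        time_interval a' b' \<subseteq> time_interval a b \<and> (\<forall>t \<in> time_interval a' b'. \<tau> t = \<sigma> t))"

(* F t x is constrained only for t in (\<alpha> x, \<beta> x). *)
definition local_flow ::
  "('a::metric_space \<Rightarrow> real \<Rightarrow> 'a) \<Rightarrow> ('a \<Rightarrow> ereal) \<Rightarrow> ('a \<Rightarrow> ereal) \<Rightarrow>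
   (real \<Rightarrow> 'a \<Rightarrow> 'a) \<Rightarrow> bool" where
  "local_flow X \<alpha> \<beta> F \<longleftrightarrow> (\<forall>x. maximal_solution_from X x (\<alpha> x) (\<beta> x) (\<lambda>t. F t x))"

(* infdist y {} = 0 in the library, but S is nonempty wherever it is used here. *)
definition locally_uniformly_tangent ::
  "'a::metric_space set \<Rightarrow> ('a \<Rightarrow> real \<Rightarrow> 'a) \<Rightarrow> bool" where
  "locally_uniformly_tangent S X \<longleftrightarrow>
     (\<forall>x \<in> S. \<exists>r>0. uniform_limit (ball x r \<inter> S) (\<lambda>t y. infdist (X y t) S / t) (\<lambda>_. 0) (at 0))"

end

theory Submission
  imports Defs
begin

text \<open>
  The distance \<open>g t = infdist (\<sigma> t) S\<close> of a solution \<open>\<sigma>\<close> to the set obeys a differential inequality.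
  Suppose \<open>\<sigma>\<close> is near a point of \<open>S\<close> at time \<open>t\<close> and let \<open>y\<close> be an almost nearest point of \<open>S\<close> to
  \<open>\<sigma> t\<close>. For small \<open>h > 0\<close>, the point \<open>\<sigma> (t + h)\<close> is within \<open>o(h)\<close> of \<open>X (\<sigma> t) h\<close> because \<open>\<sigma>\<close> solves
  \<open>X\<close>; this is within \<open>g t * (1 + h * L)\<close>, up to the error in the choice of \<open>y\<close>, of \<open>X y h\<close> by
  Condition E1; and \<open>X y h\<close> is within \<open>o(h)\<close> of \<open>S\<close> because \<open>S\<close> is tangent to \<open>X\<close>. The point \<open>y\<close>
  moves as \<open>h\<close> shrinks, so the last estimate has to be uniform in \<open>y\<close>, and this is what local
  uniform tangency gives. Altogether
  \<open>g (t + h) \<le> g t + h * (L * g t + o(1))\<close> (\<open>infdist_solution_step\<close>): the upper right Dini derivative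
  of \<open>g\<close> is at most \<open>L * g\<close>.

  A Gronwall argument (\<open>Dini_gronwall_nonpos\<close>) now shows that \<open>g\<close> remains zero for a short time after
  any time at which it is zero. As \<open>S\<close> is closed, the times at which \<open>\<sigma>\<close> lies in \<open>S\<close> form a relatively
  closed set, so \<open>\<sigma>\<close> cannot leave \<open>S\<close> in forward time (\<open>solution_stays_forward\<close>). The hypotheses
  are symmetric under \<open>t \<mapsto> - t\<close>, which settles negative times.
\<close>

section \<open>A Gronwall inequality for Dini derivatives\<close>

text \<open>
  Continuous induction on an interval: if a point \<open>t\<close> were missing, the largest element of \<open>A\<close> below
  \<open>t\<close> would exist by closedness, yet \<open>A\<close> would extend beyond it.
\<close>

lemma closed_right_extending_eq_interval:
  fixes a b :: real and A :: "real set"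
  assumes "closed A" "a \<in> A"
    and ext: "\<And>c. c \<in> A \<Longrightarrow> a \<le> c \<Longrightarrow> c < b \<Longrightarrow> eventually (\<lambda>t. t \<in> A) (at_right c)"
    and t: "t \<in> {a..b}"
  shows "t \<in> A"
proof (rule ccontr)
  assume "t \<notin> A"
  define B where "B = A \<inter> {a..t}"
  define c where "c = Sup B"
  have B: "closed B" "a \<in> B" "bdd_above B"
    using assms by (auto simp: B_def closed_Int)
  then have "c \<in> B"
    unfolding c_def using closed_contains_Sup by blast
  with \<open>t \<notin> A\<close> have c: "c \<in> A" "a \<le> c" "c < t"
    by (auto simp: B_def less_le)
  have "eventually (\<lambda>s. s \<in> A) (at_right c)"
    using ext c t by auto
  moreover have "eventually (\<lambda>s. s < t) (at_right c)"
    using c(3) by (rule order_tendstoD(2)[OF tendsto_ident_at])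
  moreover have "eventually (\<lambda>s. c < s) (at_right c)"
    by (rule eventually_at_right_less)
  ultimately have "eventually (\<lambda>s. s \<in> A \<and> s < t \<and> c < s) (at_right c)"
    by eventually_elim simp
  then obtain s where s: "s \<in> A" "s < t" "c < s"
    by (metis (mono_tags, lifting) eventually_happens trivial_limit_at_right_real)
  then have "s \<in> B"
    using c by (simp add: B_def)
  then have "s \<le> c"
    unfolding c_def using B(3) by (rule cSup_upper)
  with s show False by simp
qed

lemma eventually_at_right_shift:
  fixes c :: real
  assumes "eventually (\<lambda>h. P (c + h)) (at_right 0)"
  shows "eventually P (at_right c)"
  using assms by (subst eventually_at_right_to_0) (simp add: add.commute)

text \<open>
  For any \<open>\<eta> > 0\<close> the function \<open>\<phi> s = \<eta> * exp ((L + 1) * (s - a))\<close> is a barrier: it starts above \<open>g\<close>,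
  and its slope is \<open>L * \<phi> + \<phi> \<ge> L * \<phi> + \<eta>\<close>, so \<open>g\<close> cannot cross it. The exponent \<open>L + 1\<close> in place of
  \<open>L\<close> pays for the error \<open>\<eta>\<close> in the differential inequality.
\<close>

lemma Dini_gronwall_nonpos:
  fixes g :: "real \<Rightarrow> real"
  assumes cont: "continuous_on {a..b} g" and "g a \<le> 0" and "0 \<le> L"
    and dini: "\<And>t \<eta>. a \<le> t \<Longrightarrow> t < b \<Longrightarrow> 0 < \<eta> \<Longrightarrow>
      eventually (\<lambda>h. g (t + h) \<le> g t + h * (L * g t + \<eta>)) (at_right 0)"
    and t: "t \<in> {a..b}"
  shows "g t \<le> 0"
proof (rule field_le_epsilon)
  fix e :: real assume "0 < e"
  \<comment> \<open>Scaled so that the barrier has the value \<open>e\<close> at the time \<open>t\<close> of interest.\<close>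
  define \<eta> where "\<eta> = e / exp ((L + 1) * (t - a))"
  define \<phi> where "\<phi> s = \<eta> * exp ((L + 1) * (s - a))" for s
  define A where "A = {s \<in> {a..b}. g s \<le> \<phi> s}"
  have "0 < \<eta>"
    using \<open>0 < e\<close> by (simp add: \<eta>_def)
  have "t \<in> A"
  proof (rule closed_right_extending_eq_interval[OF _ _ _ t])
    show "closed A"
      unfolding A_def \<phi>_def
      by (intro continuous_on_closed_Collect_le cont continuous_intros closed_atLeastAtMost)
    show "a \<in> A"
      using \<open>g a \<le> 0\<close> \<open>0 < \<eta>\<close> t by (simp add: A_def \<phi>_def)
  next
    fix c assume c: "c \<in> A" "a \<le> c" "c < b"
    have step: "c + h \<in> A"
      if h: "0 < h" "c + h < b" and g: "g (c + h) \<le> g c + h * (L * g c + \<eta>)" for h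
    proof -
      have gc: "g c \<le> \<phi> c"
        using c by (simp add: A_def)
      have "\<eta> \<le> \<phi> c"
        using \<open>0 < \<eta>\<close> c \<open>0 \<le> L\<close> by (simp add: \<phi>_def)
      have "g (c + h) \<le> \<phi> c + h * (L * \<phi> c + \<phi> c)"
        using g gc \<open>\<eta> \<le> \<phi> c\<close> h \<open>0 \<le> L\<close>
        by (smt (verit) mult_left_mono)
      also have "\<dots> = \<phi> c * (1 + (L + 1) * h)"
        by (simp add: algebra_simps)
      also have "\<dots> \<le> \<phi> c * exp ((L + 1) * h)"
        using \<open>0 < \<eta>\<close> \<open>\<eta> \<le> \<phi> c\<close> by (intro mult_left_mono exp_ge_add_one_self) auto
      also have "\<dots> = \<phi> (c + h)"
        by (simp add: \<phi>_def algebra_simps flip: exp_add)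
      finally show ?thesis
        using c h by (simp add: A_def)
    qed
    have "eventually (\<lambda>h. h < b - c) (at_right 0)"
      using c by (intro order_tendstoD(2)[OF tendsto_ident_at]) simp
    then have "eventually (\<lambda>h. c + h \<in> A) (at_right 0)"
      using dini[OF c(2,3) \<open>0 < \<eta>\<close>] eventually_at_right_less[of 0]
      by eventually_elim (auto intro: step)
    then show "eventually (\<lambda>s. s \<in> A) (at_right c)"
      by (rule eventually_at_right_shift)
  qed
  then show "g t \<le> 0 + e"
    by (simp add: A_def \<phi>_def \<eta>_def)
qed

section \<open>The distance from a solution to a tangent set\<close>

lemma infdist_lessD:
  assumes "infdist x S < e" "S \<noteq> {}"
  obtains y where "y \<in> S" "dist x y < e"
  using assms by (auto simp: infdist_notempty cINF_less_iff)

lemma open_time_interval: "open (time_interval a b)"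
proof -
  have "time_interval a b = ereal -` {a<..<b}"
    by (auto simp: time_interval_def)
  then show ?thesis
    by (simp add: open_ereal_vimage)
qed

text \<open>
  The differential inequality for the distance to \<open>S\<close>. The radius \<open>r / 4\<close> leaves room for \<open>y\<close>: a point
  of \<open>S\<close> that is almost nearest to \<open>\<sigma> t\<close> is hardly farther from \<open>\<sigma> t\<close> than \<open>p\<close> is, so it stays within the
  ball about \<open>p\<close> on which the Lipschitz and tangency estimates hold.
\<close>

lemma infdist_solution_step:
  fixes X :: "'a::metric_space \<Rightarrow> real \<Rightarrow> 'a"
  assumes "0 \<le> L" "0 < \<eta>" and p: "p \<in> S"
    and lip: "\<And>x y h. x \<in> ball p r \<Longrightarrow> y \<in> ball p r \<Longrightarrow> \<bar>h\<bar> < d \<Longrightarrow>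
      dist (X x h) (X y h) \<le> dist x y * (1 + \<bar>h\<bar> * L)"
    and "0 < d"
    and tan: "uniform_limit (ball p r \<inter> S) (\<lambda>h y. infdist (X y h) S / h) (\<lambda>_. 0) (at 0)"
    and near: "dist (\<sigma> t) p < r / 4"
    and sol: "((\<lambda>h. dist (\<sigma> (t + h)) (X (\<sigma> t) h) / h) \<longlongrightarrow> 0) (at 0)"
  shows "eventually (\<lambda>h. infdist (\<sigma> (t + h)) S
      \<le> infdist (\<sigma> t) S + h * (L * infdist (\<sigma> t) S + \<eta>)) (at_right 0)"
proof -
  \<comment> \<open>The error budget has four parts of size \<open>h * \<epsilon>\<close>: one from \<open>\<sigma>\<close> being a solution, one from tangency,
    and two from the choice of \<open>y\<close>, whose error is stretched by the factor \<open>1 + h * L \<le> 2\<close>.\<close>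
  define \<epsilon> where "\<epsilon> = \<eta> / 4"
  have "0 < \<epsilon>" using \<open>0 < \<eta>\<close> by (simp add: \<epsilon>_def)
  have "0 < r" using near zero_le_dist[of "\<sigma> t" p] by linarith
  have ev1: "eventually (\<lambda>h. \<forall>y \<in> ball p r \<inter> S. dist (infdist (X y h) S / h) 0 < \<epsilon>) (at_right 0)"
    using uniform_limitD[OF tan \<open>0 < \<epsilon>\<close>] eventually_at_split by blast
  have ev2: "eventually (\<lambda>h. dist (dist (\<sigma> (t + h)) (X (\<sigma> t) h) / h) 0 < \<epsilon>) (at_right 0)"
    using tendstoD[OF sol \<open>0 < \<epsilon>\<close>] eventually_at_split by blast
  have small: "eventually (\<lambda>h::real. h < e) (at_right 0)" if "0 < e" for e
    using that by (intro order_tendstoD(2)[OF tendsto_ident_at])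
  have "0 < r / 4 / \<epsilon>" "0 < 1 / (L + 1)"
    using \<open>0 < \<epsilon>\<close> \<open>0 < r\<close> \<open>0 \<le> L\<close> by auto
  note ev = ev1 ev2 small[OF \<open>0 < d\<close>] small[OF this(1)] small[OF this(2)]
    eventually_at_right_less[of "0::real"]
  from ev show ?thesis
  proof eventually_elim
    case (elim h)
    note h = elim(3-6)
    let ?g = "infdist (\<sigma> t) S"
    have small_h: "h * \<epsilon> < r / 4"
      using h(2) \<open>0 < \<epsilon>\<close> by (metis pos_less_divide_eq)
    have "h * (L + 1) < 1"
      using h(3) \<open>0 \<le> L\<close> by (simp add: pos_less_divide_eq)
    then have "h * L \<le> 1"
      using h(4) by (simp add: algebra_simps)
    have "S \<noteq> {}" using p by blast
    \<comment> \<open>A nearest point need not exist, but an error proportional to \<open>h\<close> is harmless.\<close>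
    have "?g < ?g + h * \<epsilon>"
      using h(4) \<open>0 < \<epsilon>\<close> by simp
    then obtain y where y: "y \<in> S" "dist (\<sigma> t) y < ?g + h * \<epsilon>"
      using \<open>S \<noteq> {}\<close> by (rule infdist_lessD)
    have "?g \<le> dist (\<sigma> t) p"
      using p by (rule infdist_le)
    then have "dist p y < r"
      using \<open>0 < r\<close> y(2) near small_h dist_triangle[of p y "\<sigma> t"] by (simp add: dist_commute)
    then have yb: "y \<in> ball p r" by simp
    have sb: "\<sigma> t \<in> ball p r"
      using near \<open>0 < r\<close> by (simp add: dist_commute)
    have "dist (infdist (X y h) S / h) 0 < \<epsilon>"
      using elim(1) yb y(1) by blast
    then have a1: "infdist (X y h) S \<le> h * \<epsilon>"
      using h(4) by (simp add: infdist_nonneg pos_divide_less_eq mult.commute)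
    have a2: "dist (\<sigma> (t + h)) (X (\<sigma> t) h) \<le> h * \<epsilon>"
      using elim(2) h(4) by (simp add: pos_divide_less_eq mult.commute)
    have "dist (X (\<sigma> t) h) (X y h) \<le> dist (\<sigma> t) y * (1 + h * L)"
      using lip[OF sb yb, of h] h by simp
    also have "\<dots> \<le> (?g + h * \<epsilon>) * (1 + h * L)"
      using y(2) h(4) \<open>0 \<le> L\<close> by (intro mult_right_mono) auto
    also have "\<dots> = ?g + h * (L * ?g) + h * \<epsilon> * (1 + h * L)"
      by (simp add: algebra_simps)
    also have "\<dots> \<le> ?g + h * (L * ?g) + h * \<epsilon> * 2"
      using \<open>h * L \<le> 1\<close> h(4) \<open>0 < \<epsilon>\<close> by (intro add_left_mono mult_left_mono) auto
    finally have a3: "dist (X (\<sigma> t) h) (X y h) \<le> ?g + h * (L * ?g) + h * \<epsilon> * 2" .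
    have "infdist (\<sigma> (t + h)) S \<le> infdist (X y h) S + dist (\<sigma> (t + h)) (X y h)"
      by (rule infdist_triangle)
    also have "\<dots> \<le> infdist (X y h) S + (dist (\<sigma> (t + h)) (X (\<sigma> t) h) + dist (X (\<sigma> t) h) (X y h))"
      by (intro add_left_mono dist_triangle)
    also have "\<dots> \<le> ?g + h * (L * ?g) + 4 * (h * \<epsilon>)"
      using a1 a2 a3 by simp
    also have "\<dots> = ?g + h * (L * ?g + \<eta>)"
      by (simp add: \<epsilon>_def algebra_simps)
    finally show ?case .
  qed
qed

section \<open>Forward invariance\<close>

text \<open>
  The Lipschitz constant, the time bound and the rate of tangency are uniform only near each point,
  so the Gronwall inequality is applied on a time interval short enough to keep \<open>\<sigma>\<close> near \<open>\<sigma> c\<close>.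
\<close>

lemma solution_stays_locally:
  fixes X :: "'a::metric_space \<Rightarrow> real \<Rightarrow> 'a"
  assumes E1: "condition_E1 X" and "closed S" and tan: "locally_uniformly_tangent S X"
    and sol: "solution_curve X a b \<sigma>"
    and c: "c \<in> time_interval a b" "\<sigma> c \<in> S"
  shows "eventually (\<lambda>t. \<sigma> t \<in> S) (at_right c)"
proof -
  define p where "p = \<sigma> c"
  obtain r1 d L where "0 < r1" "0 < d" "0 < L"
    and lip: "\<And>x y h. x \<in> ball p r1 \<Longrightarrow> y \<in> ball p r1 \<Longrightarrow> \<bar>h\<bar> < d \<Longrightarrow>
      dist (X x h) (X y h) \<le> dist x y * (1 + \<bar>h\<bar> * L)"
    using E1 unfolding condition_E1_def by meson
  obtain r2 where "0 < r2"
    and tan2: "uniform_limit (ball p r2 \<inter> S) (\<lambda>h y. infdist (X y h) S / h) (\<lambda>_. 0) (at 0)"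
    using tan c(2) unfolding locally_uniformly_tangent_def p_def by blast
  define r where "r = min r1 r2"
  have "0 < r" using \<open>0 < r1\<close> \<open>0 < r2\<close> by (simp add: r_def)
  have tan_r: "uniform_limit (ball p r \<inter> S) (\<lambda>h y. infdist (X y h) S / h) (\<lambda>_. 0) (at 0)"
    using tan2 by (rule uniform_limit_on_subset) (auto simp: r_def)
  have cont: "continuous_on (time_interval a b) \<sigma>"
    using sol by (simp add: solution_curve_def)
  have nhd: "eventually (\<lambda>t. t \<in> time_interval a b) (nhds c)"
    using open_time_interval c(1) by (rule eventually_nhds_in_open)
  have "isCont \<sigma> c"
    using cont open_time_interval c(1) continuous_on_eq_continuous_at by blast
  then have "eventually (\<lambda>t. dist (\<sigma> t) p < r / 4) (nhds c)"
    using \<open>0 < r\<close> unfolding isCont_def tendsto_at_iff_tendsto_nhds p_def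
    by (intro tendstoD) auto
  with nhd have "eventually (\<lambda>t. t \<in> time_interval a b \<and> dist (\<sigma> t) p < r / 4) (nhds c)"
    by (rule eventually_conj)
  then obtain e where "0 < e" and e: "\<And>t. dist t c < e \<Longrightarrow>
      t \<in> time_interval a b \<and> dist (\<sigma> t) p < r / 4"
    by (auto simp: eventually_nhds_metric)
  define c' where "c' = c + e / 2"
  have "c < c'" using \<open>0 < e\<close> by (simp add: c'_def)
  have near: "t \<in> time_interval a b" "dist (\<sigma> t) p < r / 4" if "t \<in> {c..c'}" for t
    using e[of t] that \<open>0 < e\<close> by (auto simp: c'_def dist_real_def)
  have stay: "\<sigma> t \<in> S" if t: "t \<in> {c..c'}" for t
  proof -
    have "infdist (\<sigma> t) S \<le> 0"
    proof (rule Dini_gronwall_nonpos[OF _ _ _ _ t])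
      show "continuous_on {c..c'} (\<lambda>t. infdist (\<sigma> t) S)"
        using near(1) by (intro continuous_on_infdist continuous_on_subset[OF cont]) auto
      show "infdist (\<sigma> c) S \<le> 0" "0 \<le> L"
        using c(2) \<open>0 < L\<close> by auto
    next
      fix s \<eta> :: real assume s: "c \<le> s" "s < c'" "0 < \<eta>"
      show "eventually (\<lambda>h. infdist (\<sigma> (s + h)) S
          \<le> infdist (\<sigma> s) S + h * (L * infdist (\<sigma> s) S + \<eta>)) (at_right 0)"
      proof (rule infdist_solution_step[where r = r and d = d and p = p and X = X])
        show "((\<lambda>h. dist (\<sigma> (s + h)) (X (\<sigma> s) h) / h) \<longlongrightarrow> 0) (at 0)"
          using sol near(1)[of s] s by (simp add: solution_curve_def)
        show "dist (\<sigma> s) p < r / 4"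
          using near(2) s by simp
        show "dist (X x h) (X y h) \<le> dist x y * (1 + \<bar>h\<bar> * L)"
          if "x \<in> ball p r" "y \<in> ball p r" "\<bar>h\<bar> < d" for x y h
          using that by (intro lip) (auto simp: r_def)
      qed (use tan_r s \<open>0 < L\<close> \<open>0 < d\<close> c(2) in \<open>auto simp: p_def\<close>)
    qed
    then have "infdist (\<sigma> t) S = 0"
      using infdist_nonneg by (rule antisym)
    then show ?thesis
      using \<open>closed S\<close> c(2) in_closed_iff_infdist_zero by blast
  qed
  have "eventually (\<lambda>t. t < c') (at_right c)"
    using \<open>c < c'\<close> by (intro order_tendstoD(2)[OF tendsto_ident_at])
  then show ?thesis
    using eventually_at_right_less[of c] by eventually_elim (auto intro: stay)
qed

lemma solution_stays_forward:
  fixes X :: "'a::metric_space \<Rightarrow> real \<Rightarrow> 'a"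
  assumes "condition_E1 X" and "closed S" and "locally_uniformly_tangent S X"
    and sol: "solution_curve X a b \<sigma>"
    and zero: "0 \<in> time_interval a b" "\<sigma> 0 \<in> S"
    and t: "t \<in> time_interval a b" "0 \<le> t"
  shows "\<sigma> t \<in> S"
proof -
  have sub: "{0..t} \<subseteq> time_interval a b"
  proof
    fix s assume "s \<in> {0..t}"
    then have "ereal 0 \<le> ereal s" "ereal s \<le> ereal t" by auto
    with zero(1) t(1) show "s \<in> time_interval a b"
      unfolding time_interval_def by (blast intro: less_le_trans le_less_trans)
  qed
  define A where "A = {0..t} \<inter> \<sigma> -` S"
  have "t \<in> A"
  proof (rule closed_right_extending_eq_interval)
    have "continuous_on {0..t} \<sigma>"
      using sol sub continuous_on_subset by (auto simp: solution_curve_def)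
    then show "closed A"
      unfolding A_def using \<open>closed S\<close> by (intro continuous_closed_preimage) auto
    show "0 \<in> A" "t \<in> {0..t}"
      using zero t by (auto simp: A_def)
  next
    fix c assume c: "c \<in> A" "0 \<le> c" "c < t"
    then have "eventually (\<lambda>s. \<sigma> s \<in> S) (at_right c)"
      using sub by (intro solution_stays_locally[OF assms(1-4)]) (auto simp: A_def)
    moreover have "eventually (\<lambda>s. s < t) (at_right c)"
      using c(3) by (intro order_tendstoD(2)[OF tendsto_ident_at])
    ultimately show "eventually (\<lambda>s. s \<in> A) (at_right c)"
      using eventually_at_right_less[of c]
      by eventually_elim (use c in \<open>auto simp: A_def\<close>)
  qed
  then show ?thesis by (simp add: A_def)
qed

section \<open>Time reversal and invariance\<close>

lemma filterlim_uminus_at_0: "filterlim uminus (at 0) (at (0::real))"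
  by (simp add: filterlim_def filtermap_at_minus)

lemma condition_E1_reverse:
  assumes "condition_E1 X"
  shows "condition_E1 (\<lambda>x t. X x (- t))"
  unfolding condition_E1_def
proof
  fix x0
  obtain r d L where pos: "0 < r" "0 < d" "0 < L"
    and lip: "\<And>x y t. x \<in> ball x0 r \<Longrightarrow> y \<in> ball x0 r \<Longrightarrow> \<bar>t\<bar> < d \<Longrightarrow>
      dist (X x t) (X y t) \<le> dist x y * (1 + \<bar>t\<bar> * L)"
    using assms unfolding condition_E1_def by meson
  have "dist (X x (- t)) (X y (- t)) \<le> dist x y * (1 + \<bar>t\<bar> * L)"
    if "x \<in> ball x0 r" "y \<in> ball x0 r" "\<bar>t\<bar> < d" for x y t
    using lip[of x y "- t"] that by simp
  with pos show "\<exists>r>0. \<exists>d>0. \<exists>L>0. \<forall>x \<in> ball x0 r. \<forall>y \<in> ball x0 r. \<forall>t.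
      \<bar>t\<bar> < d \<longrightarrow> dist (X x (- t)) (X y (- t)) \<le> dist x y * (1 + \<bar>t\<bar> * L)"
    by blast
qed

text \<open>
  Tangency is a two-sided limit at time zero, so it is symmetric; the sign of the denominator is
  absorbed by comparing absolute values.
\<close>

lemma locally_uniformly_tangent_reverse:
  assumes "locally_uniformly_tangent S X"
  shows "locally_uniformly_tangent S (\<lambda>x t. X x (- t))"
  unfolding locally_uniformly_tangent_def
proof
  fix x assume "x \<in> S"
  then obtain r where "0 < r"
    and lim: "uniform_limit (ball x r \<inter> S) (\<lambda>t y. infdist (X y t) S / t) (\<lambda>_. 0) (at 0)"
    using assms unfolding locally_uniformly_tangent_def by blast
  have "uniform_limit (ball x r \<inter> S) (\<lambda>t y. infdist (X y (- t)) S / t) (\<lambda>_. 0) (at 0)"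
  proof (rule uniform_limitI)
    fix e :: real assume "0 < e"
    from uniform_limitD[OF lim this]
    have "eventually (\<lambda>t. \<forall>y \<in> ball x r \<inter> S. dist (infdist (X y (- t)) S / (- t)) 0 < e) (at 0)"
      by (rule eventually_compose_filterlim[OF _ filterlim_uminus_at_0])
    then show "eventually (\<lambda>t. \<forall>y \<in> ball x r \<inter> S. dist (infdist (X y (- t)) S / t) 0 < e) (at 0)"
      by simp
  qed
  with \<open>0 < r\<close> show "\<exists>r>0. uniform_limit (ball x r \<inter> S)
      (\<lambda>t y. infdist (X y (- t)) S / t) (\<lambda>_. 0) (at 0)"
    by blast
qed

lemma uminus_mem_time_interval:
  "- t \<in> time_interval a b \<longleftrightarrow> t \<in> time_interval (- b) (- a)"
  by (cases a; cases b) (auto simp: time_interval_def)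

lemma solution_curve_reverse:
  assumes "solution_curve X a b \<sigma>"
  shows "solution_curve (\<lambda>x t. X x (- t)) (- b) (- a) (\<lambda>t. \<sigma> (- t))"
  unfolding solution_curve_def
proof (intro conjI ballI)
  show "continuous_on (time_interval (- b) (- a)) (\<lambda>t. \<sigma> (- t))"
    by (rule continuous_on_compose2[where g = \<sigma> and t = "time_interval a b"])
      (use assms in \<open>auto simp: solution_curve_def uminus_mem_time_interval intro!: continuous_intros\<close>)
next
  fix t assume "t \<in> time_interval (- b) (- a)"
  then have "((\<lambda>h. dist (\<sigma> (- t + h)) (X (\<sigma> (- t)) h) / h) \<longlongrightarrow> 0) (at 0)"
    using assms unfolding solution_curve_def by (blast intro: uminus_mem_time_interval[THEN iffD2])
  from tendsto_minus[OF filterlim_compose[OF this filterlim_uminus_at_0]]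
  show "((\<lambda>h. dist (\<sigma> (- (t + h))) (X (\<sigma> (- t)) (- h)) / h) \<longlongrightarrow> 0) (at 0)"
    by (simp add: algebra_simps)
qed

theorem theorem39:
  fixes X :: "'a::metric_space \<Rightarrow> real \<Rightarrow> 'a"
    and \<alpha> \<beta> :: "'a \<Rightarrow> ereal"
    and F :: "real \<Rightarrow> 'a \<Rightarrow> 'a"
    and S :: "'a set"
  assumes "locally_complete TYPE('a)"
    and "arc_field X"
    and "condition_E1 X"
    and "condition_E2 X"
    and "local_flow X \<alpha> \<beta> F"
    and "closed S"
    and "locally_uniformly_tangent S X"
  shows "\<forall>x \<in> S. \<forall>t \<in> time_interval (\<alpha> x) (\<beta> x). F t x \<in> S"
proof (intro ballI)
  fix x t assume x: "x \<in> S" and t: "t \<in> time_interval (\<alpha> x) (\<beta> x)"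
  have sol: "0 \<in> time_interval (\<alpha> x) (\<beta> x)" "F 0 x = x"
    "solution_curve X (\<alpha> x) (\<beta> x) (\<lambda>t. F t x)"
    using assms(5) by (auto simp: local_flow_def maximal_solution_from_def solution_from_def)
  show "F t x \<in> S"
  proof (cases "0 \<le> t")
    case True
    then show ?thesis
      using solution_stays_forward[OF assms(3,6,7) sol(3,1)] sol(2) x t by simp
  next
    case False
    have "F (- (- t)) x \<in> S"
    proof (rule solution_stays_forward[OF condition_E1_reverse[OF assms(3)] assms(6)
          locally_uniformly_tangent_reverse[OF assms(7)] solution_curve_reverse[OF sol(3)]])
      show "0 \<in> time_interval (- \<beta> x) (- \<alpha> x)" "- t \<in> time_interval (- \<beta> x) (- \<alpha> x)"
        using sol(1) t by (simp_all flip: uminus_mem_time_interval)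
    qed (use False sol(2) x in auto)
    then show ?thesis by simp
  qed
qed

end
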